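(* Let $k\ge1$, $S\ge0$, $t\ge0$, and write $S=2^{t+1}Q+r$ with integers $Q\ge 0$ and $0\le r<2^{t+1}$. Let $Z_t(k,S)$ be the number of degree-$S$ monomials $g\in\mathcal P_k$ with $\mathrm{Sq}^{2^t}(g)=0$. Then $$Z_t(k,S)=\begin{cases}\displaystyle\binom{Q+k-1}{k-1}\binom{r+k-1}{k-1},& r<2^t,\\[4pt] 0,& r\ge2^t.\end{cases}$$
   Context: $\mathcal P_k=\mathbb F_2[x_1,\dots,x_k]$ with $\deg x_i=1$. For $e\in\mathbb N^k$ ($\mathbb N$ includes $0$), $x^e=\prod x_i^{e_i}$, $|e|=\sum e_i$. Steenrod squares act linearly by $\mathrm{Sq}^r(x^a)=\sum_{b\in\mathbb N^k,|b|=r}\prod_i\binom{a_i}{b_i}x^{a+b}$ (mod 2). *)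

theory Defs
  imports Main "HOL-Library.Poly_Mapping" "HOL-Library.Z2"
begin

text \<open>
  An exponent vector is a finitely supported function from variable indices to \<open>nat\<close>; a polynomial
  over the two-element field \<^typ>\<open>bit\<close> is a finitely supported function from exponent vectors to
  coefficients.  The ring structure is the one of \<^theory>\<open>HOL-Library.Poly_Mapping\<close>.
\<close>

type_synonym expo = "nat \<Rightarrow>\<^sub>0 nat"
type_synonym f2poly = "expo \<Rightarrow>\<^sub>0 bit"

definition expos :: "nat \<Rightarrow> expo set" where
  "expos k = {e. Poly_Mapping.keys e \<subseteq> {1..k}}"

definition tdeg :: "expo \<Rightarrow> nat" where
  "tdeg e = (\<Sum>i\<in>Poly_Mapping.keys e. Poly_Mapping.lookup e i)"

definition poly_F2 :: "nat \<Rightarrow> f2poly set" where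
  "poly_F2 k = {p. Poly_Mapping.keys p \<subseteq> expos k}"

definition xpow :: "expo \<Rightarrow> f2poly" where
  "xpow e = Poly_Mapping.single e 1"

definition sq_monom :: "nat \<Rightarrow> nat \<Rightarrow> expo \<Rightarrow> f2poly" where
  "sq_monom k r a =
     (\<Sum>b | b \<in> expos k \<and> tdeg b = r.
        of_nat (\<Prod>i=1..k. Poly_Mapping.lookup a i choose Poly_Mapping.lookup b i) * xpow (a + b))"

text \<open>
  The linear extension of \<open>sq_monom\<close>: over the field with two elements a polynomial is the sum of
  the monomials \<open>xpow a\<close> with \<open>a\<close> ranging over its support (see \<open>f2poly_eq_sum\<close>, \<open>Sq_xpow\<close>,
  \<open>Sq_add\<close> below).
\<close>

definition Sq :: "nat \<Rightarrow> nat \<Rightarrow> f2poly \<Rightarrow> f2poly" where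
  "Sq k r p = (\<Sum>a\<in>Poly_Mapping.keys p. sq_monom k r a)"

definition monomials :: "nat \<Rightarrow> nat \<Rightarrow> f2poly set" where
  "monomials k S = {g \<in> poly_F2 k. \<exists>e. g = xpow e \<and> tdeg e = S}"

definition num_killed :: "nat \<Rightarrow> nat \<Rightarrow> nat \<Rightarrow> nat" where
  "num_killed t k S = card {g \<in> monomials k S. Sq k (2 ^ t) g = 0}"

lemma f2poly_eq_sum: "p = (\<Sum>a\<in>Poly_Mapping.keys p. xpow a)" for p :: f2poly
proof (rule poly_mapping_eqI)
  fix e
  show "Poly_Mapping.lookup p e = Poly_Mapping.lookup (\<Sum>a\<in>Poly_Mapping.keys p. xpow a) e"
    by (cases "e \<in> Poly_Mapping.keys p")
       (simp_all add: lookup_sum xpow_def lookup_single when_def in_keys_iff)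
qed

lemma Sq_xpow: "Sq k r (xpow a) = sq_monom k r a"
  by (simp add: Sq_def xpow_def)

lemma Sq_add: "Sq k r (p + q) = Sq k r p + Sq k r q"
proof -
  have double: "u + u = 0" for u :: f2poly
  proof (rule poly_mapping_eqI)
    show "Poly_Mapping.lookup (u + u) e = Poly_Mapping.lookup 0 e" for e
      by (simp only: lookup_add lookup_zero) simp
  qed
  define f where "f = (\<lambda>a (c::bit). if c = 0 then 0 else sq_monom k r a)"
  have *: "Sq k r p = (\<Sum>a\<in>Poly_Mapping.keys p. f a (Poly_Mapping.lookup p a))" for p
    by (auto simp: Sq_def f_def in_keys_iff intro!: sum.cong)
  show ?thesis
    unfolding * by (rule setsum_keys_plus_distrib) (auto simp: f_def double)
qed

text \<open>Finiteness of the index set in \<open>sq_monom\<close> and of the set counted by \<open>num_killed\<close>.\<close>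

lemma finite_expos_tdeg: "finite {b \<in> expos k. tdeg b = r}"
proof -
  let ?F = "{f :: nat \<Rightarrow> nat. \<forall>i. (i \<in> {1..k} \<longrightarrow> f i \<in> {..r}) \<and> (i \<notin> {1..k} \<longrightarrow> f i = 0)}"
  have le: "Poly_Mapping.lookup b i \<le> tdeg b" for b i
    by (cases "i \<in> Poly_Mapping.keys b") (auto simp: tdeg_def in_keys_iff intro: member_le_sum)
  have "finite ?F"
    by (rule finite_set_of_finite_funs) auto
  moreover have "Poly_Mapping.lookup ` {b \<in> expos k. tdeg b = r} \<subseteq> ?F"
    using le by (auto simp: expos_def in_keys_iff subset_iff)
  ultimately have "finite (Poly_Mapping.lookup ` {b \<in> expos k. tdeg b = r})"
    by (rule finite_subset[rotated])
  then show ?thesis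
    by (rule finite_imageD) (auto simp: inj_on_def intro: poly_mapping_eqI)
qed

lemma finite_monomials: "finite (monomials k S)"
proof -
  have "monomials k S \<subseteq> xpow ` {e \<in> expos k. tdeg e = S}"
    by (auto simp: monomials_def poly_F2_def xpow_def)
  then show ?thesis
    using finite_expos_tdeg finite_subset by blast
qed

end

theory Submission
  imports Defs
begin

text \<open>
  The target monomials \<open>x^(a + b)\<close> of \<open>Sq^r (x^a)\<close> are distinct for distinct \<open>b\<close>, so nothing
  cancels: \<open>Sq^r\<close> kills \<open>x^a\<close> exactly when no \<open>b\<close> of degree \<open>r\<close> has all \<open>a\<^sub>i choose b\<^sub>i\<close> odd.

  For \<open>r = 2^t\<close> such a \<open>b\<close> exists if and only if the residues \<open>a\<^sub>i mod 2^(t+1)\<close> add up to at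
  least \<open>2^t\<close> (\<open>odd_binomials_iff\<close>).  By Lucas, oddness of \<open>a\<^sub>i choose b\<^sub>i\<close> means that the binary
  digits of \<open>b\<^sub>i\<close> are among those of \<open>a\<^sub>i\<close>.  As \<open>b\<^sub>i \<le> 2^t\<close>, only the digits of the residue matter,
  which gives necessity.  For sufficiency one starts with \<open>b\<^sub>i = a\<^sub>i mod 2^(t+1)\<close> and keeps deleting
  a lowest binary digit \<open>2^j\<close> occurring among all the \<open>b\<^sub>i\<close>.  Both the current total and \<open>2^t\<close> are
  multiples of \<open>2^j\<close>, so the total cannot jump below \<open>2^t\<close> and eventually equals it.

  Finally, division with remainder by \<open>2^(t+1)\<close> in every coordinate writes \<open>a\<close> as
  \<open>2^(t+1) q + \<rho>\<close>.  If \<open>x^a\<close> is killed, then \<open>tdeg \<rho> < 2^t\<close>, so uniqueness of division with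
  remainder in \<open>tdeg a = 2^(t+1) tdeg q + tdeg \<rho>\<close> forces \<open>tdeg q = Q\<close> and \<open>tdeg \<rho> = r\<close>.
  Conversely every such pair \<open>(q, \<rho>)\<close> with \<open>r < 2^t\<close> occurs, and both factors are counted by
  stars and bars.
\<close>

section \<open>Binomial coefficients modulo two\<close>

text \<open>
  One binary digit of Lucas' theorem.  Stripping one digit at a time is all that the inductions
  below need.
\<close>

lemma odd_choose_strip_digit:
  "odd (a choose b) \<longleftrightarrow> odd (a div 2 choose (b div 2)) \<and> (odd b \<longrightarrow> odd a)"
proof -
  have double: "(odd (2 * n choose (2 * m)) \<longleftrightarrow> odd (n choose m)) \<and>
      even (2 * n choose Suc (2 * m))" for n m :: nat
  proof (induction n arbitrary: m)
    case 0
    then show ?case by (cases m) auto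
  next
    case (Suc n)
    show ?case using Suc.IH[of m] Suc.IH[of "m - 1"] by (cases m) simp_all
  qed
  have Suc_double: "odd (Suc (2 * n) choose (2 * m)) \<longleftrightarrow> odd (n choose m)" for n m :: nat
    using double[of n m] double[of n "m - 1"] by (cases m) simp_all
  show ?thesis
  proof (cases "even a")
    case True
    then obtain n where a: "a = 2 * n" by (rule evenE)
    show ?thesis
    proof (cases "even b")
      case True
      then obtain m where "b = 2 * m" by (rule evenE)
      then show ?thesis using double[of n m] by (simp add: a)
    next
      case False
      then obtain m where "b = Suc (2 * m)" by (metis oddE Suc_eq_plus1)
      then show ?thesis using double[of n m] by (simp add: a)
    qed
  next
    case False
    then obtain n where a: "a = Suc (2 * n)" by (metis oddE Suc_eq_plus1)
    show ?thesis
    proof (cases "even b")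
      case True
      then obtain m where "b = 2 * m" by (rule evenE)
      then show ?thesis using Suc_double[of n m] by (simp add: a)
    next
      case False
      then obtain m where "b = Suc (2 * m)" by (metis oddE Suc_eq_plus1)
      then show ?thesis using double[of n m] by (simp add: a)
    qed
  qed
qed

lemma odd_choose_mod_iff:
  assumes "b < 2 ^ m"
  shows "odd (a choose b) \<longleftrightarrow> odd (a mod 2 ^ m choose b)"
  using assms
proof (induction m arbitrary: a b)
  case 0
  then show ?case by simp
next
  case (Suc m)
  have "a mod 2 ^ Suc m div 2 = a div 2 mod 2 ^ m"
    by (simp add: mod_mult2_eq)
  moreover have "even (a mod 2 ^ Suc m) \<longleftrightarrow> even a"
    using dvd_mod_iff[of 2 "2 ^ Suc m" a] by simp
  moreover have "odd (a div 2 choose (b div 2)) \<longleftrightarrow> odd (a div 2 mod 2 ^ m choose (b div 2))"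
  proof (rule Suc.IH)
    show "b div 2 < 2 ^ m" using Suc.prems by simp
  qed
  ultimately show ?case
    using odd_choose_strip_digit[of a b] odd_choose_strip_digit[of "a mod 2 ^ Suc m" b] by simp
qed

text \<open>Digits of \<open>b\<close> are digits of \<open>a\<close>, so those below \<open>2^m\<close> already occur in \<open>a mod 2^m\<close>.\<close>

lemma odd_choose_imp_le_mod:
  assumes "odd (a choose b)" and "b < 2 ^ m"
  shows "b \<le> a mod 2 ^ m"
proof (rule ccontr)
  assume "\<not> b \<le> a mod 2 ^ m"
  then have "(a mod 2 ^ m choose b) = 0" by (simp add: binomial_eq_0)
  then show False using assms odd_choose_mod_iff[of b m a] by (metis dvd_0_right)
qed

lemma odd_choose_mod_self: "odd (a choose (a mod 2 ^ m))"
  using odd_choose_mod_iff[of "a mod 2 ^ m" m a] by simp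

text \<open>
  The hypotheses say that \<open>2^j\<close> is the lowest binary digit of \<open>b\<close>; deleting it leaves the
  remaining digits among those of \<open>a\<close>.
\<close>

lemma odd_choose_delete_lowest_digit:
  assumes "odd (a choose b)" and "2 ^ j dvd b" and "\<not> 2 ^ Suc j dvd b"
  shows "odd (a choose (b - 2 ^ j))"
  using assms
proof (induction j arbitrary: a b)
  case 0
  then have "odd b" by simp
  then have "(b - 1) div 2 = b div 2" by (auto elim!: oddE)
  then show ?case
    using 0 \<open>odd b\<close> odd_choose_strip_digit[of a b] odd_choose_strip_digit[of a "b - 1"] by auto
next
  case (Suc j)
  then obtain c where b: "b = 2 * c" by (metis dvd_def dvd_mult_left power_Suc)
  have "odd (a div 2 choose (c - 2 ^ j))"
    using Suc odd_choose_strip_digit[of a b] by (auto simp: b)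
  moreover have "b - 2 ^ Suc j = 2 * (c - 2 ^ j)" by (simp add: b right_diff_distrib')
  ultimately show ?case
    using odd_choose_strip_digit[of a "b - 2 ^ Suc j"] by simp
qed

text \<open>
  The choice of \<open>j\<close> as the lowest digit over the whole family, rather than over one member, makes
  the total a multiple of \<open>2^j\<close>.  The bound on the \<open>b i\<close> gives \<open>j \<le> t\<close>, so \<open>2^t\<close> is a multiple
  as well, and a total above \<open>2^t\<close> is at least \<open>2^t + 2^j\<close>.
\<close>

lemma odd_binomials_shrink_sum:
  fixes a b :: "'i \<Rightarrow> nat"
  assumes "finite I" and "\<And>i. i \<in> I \<Longrightarrow> odd (a i choose b i)"
    and "\<And>i. i \<in> I \<Longrightarrow> b i < 2 ^ Suc t" and "2 ^ t \<le> sum b I"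
  shows "\<exists>c. (\<forall>i\<in>I. odd (a i choose c i)) \<and> sum c I = 2 ^ t"
  using assms(2-)
proof (induction "sum b I" arbitrary: b rule: less_induct)
  case less
  show ?case
  proof (cases "sum b I = 2 ^ t")
    case True
    then show ?thesis using less.prems(1) by blast
  next
    case False
    then have large: "2 ^ t < sum b I" using less.prems(3) by simp
    define j where "j = (LEAST j. \<exists>i\<in>I. \<not> 2 ^ Suc j dvd b i)"
    obtain i0 where "i0 \<in> I" "b i0 \<noteq> 0"
      using large by (metis not_less_zero sum.neutral)
    then have ex: "\<exists>i\<in>I. \<not> 2 ^ Suc t dvd b i"
      using less.prems(2) by (metis dvd_imp_le gr0I not_le)
    then have "j \<le> t" unfolding j_def by (rule Least_le)
    from ex have "\<exists>i\<in>I. \<not> 2 ^ Suc j dvd b i" unfolding j_def by (rule LeastI)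
    then obtain i where i: "i \<in> I" "\<not> 2 ^ Suc j dvd b i" by blast
    have dvd: "2 ^ j dvd b i'" if "i' \<in> I" for i'
    proof (cases j)
      case (Suc j')
      then have "j' < j" by simp
      then have "\<forall>i\<in>I. 2 ^ Suc j' dvd b i" unfolding j_def using not_less_Least by blast
      then show ?thesis using that Suc by simp
    qed simp
    then have "2 ^ j dvd sum b I - 2 ^ t"
      using \<open>j \<le> t\<close> by (intro dvd_diff_nat dvd_sum le_imp_power_dvd)
    then have "2 ^ j \<le> sum b I - 2 ^ t"
      using large by (intro dvd_imp_le) auto
    then have step: "2 ^ t \<le> sum b I - 2 ^ j"
      using large by linarith
    have "2 ^ j \<le> b i" using i dvd[OF i(1)] by (intro dvd_imp_le) (auto intro: gr0I)
    define c where "c = b(i := b i - 2 ^ j)"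
    have "sum c I = (b i - 2 ^ j) + sum b (I - {i})" "sum b I = b i + sum b (I - {i})"
      using assms(1) i(1) by (auto simp: c_def sum.remove)
    with \<open>2 ^ j \<le> b i\<close> have sum_c: "sum c I = sum b I - 2 ^ j" by simp
    show ?thesis
    proof (rule less.hyps[of c])
      show "sum c I < sum b I" using sum_c large by simp
      show "odd (a i' choose c i')" if "i' \<in> I" for i'
        using odd_choose_delete_lowest_digit[OF less.prems(1) dvd] i that
        by (auto simp: c_def less.prems(1))
      show "c i' < 2 ^ Suc t" if "i' \<in> I" for i'
        using less.prems(2)[OF that] by (auto simp: c_def)
      show "2 ^ t \<le> sum c I" using step sum_c by simp
    qed
  qed
qed

lemma odd_binomials_iff:
  fixes a :: "'i \<Rightarrow> nat"
  assumes "finite I"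
  shows "(\<exists>b. (\<forall>i\<in>I. odd (a i choose b i)) \<and> sum b I = 2 ^ t)
    \<longleftrightarrow> 2 ^ t \<le> (\<Sum>i\<in>I. a i mod 2 ^ Suc t)" (is "?L \<longleftrightarrow> ?R")
proof
  assume ?L
  then obtain b where b: "\<And>i. i \<in> I \<Longrightarrow> odd (a i choose b i)" "sum b I = 2 ^ t" by blast
  have "b i \<le> a i mod 2 ^ Suc t" if "i \<in> I" for i
  proof (rule odd_choose_imp_le_mod[OF b(1)[OF that]])
    have "b i \<le> 2 ^ t" using member_le_sum[OF that, of b] assms b(2) by simp
    then show "b i < 2 ^ Suc t" by (simp add: le_less_trans)
  qed
  then show ?R using b(2) sum_mono[of I b] by metis
next
  assume ?R
  then show ?L
    by (intro odd_binomials_shrink_sum[where b = "\<lambda>i. a i mod 2 ^ Suc t"] assms odd_choose_mod_self)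
       auto
qed

section \<open>Exponent vectors\<close>

lemma expos_iff: "e \<in> expos k \<longleftrightarrow> (\<forall>i. i \<notin> {1..k} \<longrightarrow> Poly_Mapping.lookup e i = 0)"
  by (auto simp: expos_def in_keys_iff subset_iff)

lemma tdeg_expos: "e \<in> expos k \<Longrightarrow> tdeg e = (\<Sum>i=1..k. Poly_Mapping.lookup e i)"
  unfolding tdeg_def expos_def by (rule sum.mono_neutral_left) (auto simp: in_keys_iff)

lemma expos_add: "a \<in> expos k \<Longrightarrow> b \<in> expos k \<Longrightarrow> a + b \<in> expos k"
  by (simp add: expos_iff lookup_add)

lemma lookup_map_zero:
  "f 0 = 0 \<Longrightarrow> Poly_Mapping.lookup (Poly_Mapping.map f e) i = f (Poly_Mapping.lookup e i)"
  by (simp add: Poly_Mapping.map.rep_eq when_def)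

lemma expos_map: "f 0 = 0 \<Longrightarrow> e \<in> expos k \<Longrightarrow> Poly_Mapping.map f e \<in> expos k"
  by (simp add: expos_iff lookup_map_zero)

lemma tdeg_map:
  "f 0 = 0 \<Longrightarrow> e \<in> expos k \<Longrightarrow> tdeg (Poly_Mapping.map f e) = (\<Sum>i=1..k. f (Poly_Mapping.lookup e i))"
  by (simp add: tdeg_expos[OF expos_map] lookup_map_zero)

lemma ex_expos_lookup: "\<exists>e\<in>expos k. \<forall>i\<in>{1..k}. Poly_Mapping.lookup e i = f i"
proof
  let ?g = "\<lambda>i. if i \<in> {1..k} then f i else 0"
  have "finite {i. ?g i \<noteq> 0}" by (rule finite_subset[of _ "{1..k}"]) auto
  then have *: "Poly_Mapping.lookup (Abs_poly_mapping ?g) = ?g" by simp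
  show "Abs_poly_mapping ?g \<in> expos k" "\<forall>i\<in>{1..k}. Poly_Mapping.lookup (Abs_poly_mapping ?g) i = f i"
    unfolding expos_iff * by simp_all
qed

text \<open>Stars and bars, transported from lists of length \<open>k\<close>.\<close>

lemma card_expos_tdeg:
  assumes "k \<ge> 1"
  shows "card {e \<in> expos k. tdeg e = N} = (N + k - 1) choose (k - 1)"
proof -
  let ?list = "\<lambda>e. map (Poly_Mapping.lookup e) [1..<Suc k]"
  have sum_list: "sum_list (?list e) = tdeg e" if "e \<in> expos k" for e
    by (subst interv_sum_list_conv_sum_set_nat)
       (simp only: tdeg_expos[OF that] set_upt atLeastLessThanSuc_atLeastAtMost)
  have "bij_betw ?list {e \<in> expos k. tdeg e = N} {l. length l = k \<and> sum_list l = N}"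
  proof (rule bij_betw_imageI)
    show "inj_on ?list {e \<in> expos k. tdeg e = N}"
    proof (rule inj_onI, rule poly_mapping_eqI)
      fix d e i
      assume d: "d \<in> {e \<in> expos k. tdeg e = N}" and e: "e \<in> {e \<in> expos k. tdeg e = N}"
        and eq: "?list d = ?list e"
      show "Poly_Mapping.lookup d i = Poly_Mapping.lookup e i"
      proof (cases "i \<in> {1..k}")
        case True
        then have "i \<in> set [1..<Suc k]" by auto
        with eq show ?thesis by (simp only: map_eq_conv)
      qed (use d e in \<open>simp add: expos_iff\<close>)
    qed
    show "?list ` {e \<in> expos k. tdeg e = N} = {l. length l = k \<and> sum_list l = N}" (is "?A = ?B")
    proof
      show "?A \<subseteq> ?B" using sum_list by auto
      show "?B \<subseteq> ?A"
      proof
        fix l assume l: "l \<in> ?B"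
        obtain e where e: "e \<in> expos k" "\<forall>i\<in>{1..k}. Poly_Mapping.lookup e i = l ! (i - 1)"
          using ex_expos_lookup[of k "\<lambda>i. l ! (i - 1)"] by blast
        then have "?list e = l"
          using l by (intro nth_equalityI) (auto simp del: upt_Suc)
        then show "l \<in> ?A" using l e(1) sum_list[OF e(1)] by force
      qed
    qed
  qed
  then have "card {e \<in> expos k. tdeg e = N} = (N + k - 1) choose N"
    using card_length_sum_list by (simp add: bij_betw_same_card)
  also have "\<dots> = (N + k - 1) choose (k - 1)"
    using assms binomial_symmetric[of N "N + k - 1"] by simp
  finally show ?thesis .
qed

section \<open>Monomials killed by a Steenrod square\<close>

text \<open>
  No cancellation: since addition of exponents is cancellative, the coefficient at \<open>a + b\<close> is the
  single product of binomial coefficients belonging to \<open>b\<close>.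
\<close>

lemma sq_monom_eq_0_iff:
  "sq_monom k r a = 0 \<longleftrightarrow>
    (\<forall>b\<in>expos k. tdeg b = r \<longrightarrow>
      (\<exists>i\<in>{1..k}. even (Poly_Mapping.lookup a i choose Poly_Mapping.lookup b i)))"
proof -
  let ?c = "\<lambda>b. \<Prod>i=1..k. Poly_Mapping.lookup a i choose Poly_Mapping.lookup b i"
  let ?W = "{b \<in> expos k. tdeg b = r}"
  have of_nat_mult_xpow: "of_nat n * xpow e = Poly_Mapping.single e (of_nat n)" for n e
    unfolding xpow_def single_of_nat[symmetric] mult_single by simp
  have of_nat_bit: "(of_nat n :: bit) = 0 \<longleftrightarrow> even n" for n
    by (induction n) auto
  have sum: "sq_monom k r a = (\<Sum>b\<in>?W. Poly_Mapping.single (a + b) (of_nat (?c b)))"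
    unfolding sq_monom_def of_nat_mult_xpow ..
  have coeff: "Poly_Mapping.lookup (sq_monom k r a) (a + b) = of_nat (?c b)" if "b \<in> ?W" for b
  proof -
    have "Poly_Mapping.lookup (sq_monom k r a) (a + b) = (\<Sum>b'\<in>?W. if b' = b then of_nat (?c b') else 0)"
      by (simp only: sum lookup_sum lookup_single when_def add_left_cancel)
    also have "\<dots> = of_nat (?c b)"
      by (subst sum.delta[OF finite_expos_tdeg]) (rule if_P[OF that])
    finally show ?thesis .
  qed
  have "sq_monom k r a = 0 \<longleftrightarrow> (\<forall>b\<in>?W. (of_nat (?c b) :: bit) = 0)"
  proof
    assume zero: "sq_monom k r a = 0"
    show "\<forall>b\<in>?W. (of_nat (?c b) :: bit) = 0"
      using coeff unfolding zero lookup_zero by (intro ballI) (rule sym)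
  next
    assume zero: "\<forall>b\<in>?W. (of_nat (?c b) :: bit) = 0"
    show "sq_monom k r a = 0"
      unfolding sum
    proof (rule sum.neutral, rule ballI)
      fix b assume "b \<in> ?W"
      with zero have "(of_nat (?c b) :: bit) = 0" by (rule bspec)
      then show "Poly_Mapping.single (a + b) (of_nat (?c b) :: bit) = 0" by (simp only: single_zero)
    qed
  qed
  then show ?thesis by (simp only: of_nat_bit even_prod_iff[OF finite_atLeastAtMost]) blast
qed

lemma Sq_two_power_xpow_eq_0_iff:
  assumes "a \<in> expos k"
  shows "Sq k (2 ^ t) (xpow a) = 0 \<longleftrightarrow>
    tdeg (Poly_Mapping.map (\<lambda>n. n mod 2 ^ Suc t) a) < 2 ^ t"
proof -
  let ?P = "\<lambda>b. \<forall>i\<in>{1..k}. odd (Poly_Mapping.lookup a i choose b i)"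
  have "Sq k (2 ^ t) (xpow a) \<noteq> 0 \<longleftrightarrow>
      (\<exists>b\<in>expos k. ?P (Poly_Mapping.lookup b) \<and> tdeg b = 2 ^ t)"
    unfolding Sq_xpow sq_monom_eq_0_iff by blast
  also have "\<dots> \<longleftrightarrow> (\<exists>b. ?P b \<and> sum b {1..k} = 2 ^ t)"
  proof
    assume "\<exists>b. ?P b \<and> sum b {1..k} = 2 ^ t"
    then obtain b where b: "?P b" "sum b {1..k} = 2 ^ t" by blast
    obtain e where e: "e \<in> expos k" "\<forall>i\<in>{1..k}. Poly_Mapping.lookup e i = b i"
      using ex_expos_lookup by blast
    then have "tdeg e = 2 ^ t" using b(2) by (simp add: tdeg_expos)
    moreover have "?P (Poly_Mapping.lookup e)" using b(1) e(2) by metis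
    ultimately show "\<exists>b\<in>expos k. ?P (Poly_Mapping.lookup b) \<and> tdeg b = 2 ^ t"
      using e(1) by blast
  qed (auto simp: tdeg_expos)
  also have "\<dots> \<longleftrightarrow> 2 ^ t \<le> tdeg (Poly_Mapping.map (\<lambda>n. n mod 2 ^ Suc t) a)"
    using odd_binomials_iff[of "{1..k}"] tdeg_map[OF _ assms, of "\<lambda>n. n mod 2 ^ Suc t"] by simp
  finally show ?thesis by linarith
qed

section \<open>Counting by division with remainder\<close>

theorem proposition3p8:
  fixes k S t Q r :: nat
  assumes "k \<ge> 1"
    and "S = 2 ^ (t + 1) * Q + r"
    and "r < 2 ^ (t + 1)"
  shows "num_killed t k S =
    (if r < 2 ^ t then ((Q + k - 1) choose (k - 1)) * ((r + k - 1) choose (k - 1)) else 0)"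
proof -
  define D :: nat where "D = 2 ^ Suc t"
  have "D > 0" by (simp add: D_def)
  have S: "S = D * Q + r" "r < D" using assms by (simp_all add: D_def)
  define quot :: "expo \<Rightarrow> expo" where "quot = Poly_Mapping.map (\<lambda>n. n div D)"
  define rem :: "expo \<Rightarrow> expo" where "rem = Poly_Mapping.map (\<lambda>n. n mod D)"
  define comb where "comb = (\<lambda>(q, \<rho>). Poly_Mapping.map (\<lambda>n. D * n) q + (\<rho> :: expo))"
  let ?W = "\<lambda>N. {e \<in> expos k. tdeg e = N}"
  define K where "K = {a \<in> ?W S. tdeg (rem a) < 2 ^ t}"
  have "{g \<in> monomials k S. Sq k (2 ^ t) g = 0} = xpow ` K"
    using Sq_two_power_xpow_eq_0_iff
    by (auto simp: monomials_def poly_F2_def xpow_def K_def rem_def D_def)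
  moreover have "inj_on xpow K"
    by (rule inj_onI) (metis xpow_def keys_single singleton_inject zero_neq_one)
  ultimately have num: "num_killed t k S = card K"
    by (simp add: num_killed_def card_image)
  have tdeg_div: "tdeg a = D * tdeg (quot a) + tdeg (rem a)" if "a \<in> expos k" for a
    using that by (simp add: tdeg_expos tdeg_map quot_def rem_def sum_distrib_left flip: sum.distrib)
  have K_degrees: "tdeg (quot a) = Q \<and> tdeg (rem a) = r" if "a \<in> K" for a
  proof -
    have "tdeg (rem a) < D" using that by (simp add: K_def D_def)
    moreover have "D * tdeg (quot a) + tdeg (rem a) = D * Q + r"
      using that tdeg_div[of a] S(1) by (simp add: K_def)
    moreover have "(D * m + n) div D = m" "(D * m + n) mod D = n" if "n < D" for m n
      using that by simp_all
    ultimately show ?thesis using S(2) by metis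
  qed
  show ?thesis
  proof (cases "r < 2 ^ t")
    case True
    have "bij_betw (\<lambda>a. (quot a, rem a)) K (?W Q \<times> ?W r)"
    proof (rule bij_betw_byWitness[where f' = comb])
      show "\<forall>a\<in>K. comb (quot a, rem a) = a"
        by (auto intro!: poly_mapping_eqI simp: comb_def quot_def rem_def lookup_add lookup_map_zero)
      show "(\<lambda>a. (quot a, rem a)) ` K \<subseteq> ?W Q \<times> ?W r"
        using K_degrees by (auto simp: K_def quot_def rem_def expos_map)
      have comb: "quot (comb (q, \<rho>)) = q \<and> rem (comb (q, \<rho>)) = \<rho> \<and> comb (q, \<rho>) \<in> ?W S"
        if q: "q \<in> ?W Q" and \<rho>: "\<rho> \<in> ?W r" for q \<rho>
      proof -
        \<comment> \<open>No carries: the coordinates of \<open>\<rho>\<close> are genuine remainders because their sum is below \<open>D\<close>.\<close>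
        have small: "Poly_Mapping.lookup \<rho> i < D" for i
        proof (cases "i \<in> {1..k}")
          case True
          then have "Poly_Mapping.lookup \<rho> i \<le> r"
            using \<rho> member_le_sum[of i "{1..k}" "Poly_Mapping.lookup \<rho>"] tdeg_expos[of \<rho> k] by simp
          then show ?thesis using S(2) by simp
        qed (use \<rho> \<open>D > 0\<close> in \<open>simp add: expos_iff\<close>)
        have "quot (comb (q, \<rho>)) = q" "rem (comb (q, \<rho>)) = \<rho>"
          using small \<open>D > 0\<close>
          by (auto intro!: poly_mapping_eqI
              simp: comb_def quot_def rem_def lookup_add lookup_map_zero)
        moreover have "comb (q, \<rho>) \<in> expos k"
          using q \<rho> by (simp add: comb_def expos_add expos_map)
        ultimately show ?thesis
          using tdeg_div[of "comb (q, \<rho>)"] q \<rho> S(1) by simp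
      qed
      then show "\<forall>p\<in>?W Q \<times> ?W r. (quot (comb p), rem (comb p)) = p" by auto
      show "comb ` (?W Q \<times> ?W r) \<subseteq> K"
        using comb True by (auto simp: K_def)
    qed
    then have "card K = card (?W Q) * card (?W r)"
      by (simp add: bij_betw_same_card card_cartesian_product)
    then show ?thesis
      using True num by (simp add: card_expos_tdeg[OF assms(1)])
  next
    case False
    then have "K = {}" using K_degrees by (auto simp: K_def)
    then show ?thesis using False num by simp
  qed
qed

end
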